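(* Let $A\in\mathbb{R}^{d\times d}$, let $f:\mathbb{R}^d\to\mathbb{R}^d$ be a $C^r$ map with $r\ge1$, $d\ge1$, such that the DAE $A\dot z=f(z)$ is regular with configuration space $\mathcal{M}$, and let the $C^{r+1}$ function $V:\mathbb{R}^d\to\mathbb{R}$ be a proper dissipated quantity of this DAE. Then there exists a matrix function $S:\mathbb{R}^d\to\mathbb{R}^{d\times d}$ such that $S$ is $C^r$ and $f=S\nabla V$ on the domain $\{z\in\mathbb{R}^d\mid\langle A^\dagger f(z),\nabla V(z)\rangle\ne0\}$, and $A^\dagger S(z)$ is negative semidefinite for every $z\in\mathcal{M}$.
   Context: $A^\dagger$ is the Moore--Penrose inverse of $A$; $A$ may be singular. A (not necessarily symmetric) matrix $X\in\mathbb{R}^{d\times d}$ is negative semidefinite if $\langle x,Xx\rangle\le0$ for all $x\in\mathbb{R}^d$. The DAE $A\dot z=f(z)$ is called regular if there are a differentiable submanifold $\mathcal{M}$ of $\mathbb{R}^d$ (the configuration space) and a vector field $v:\mathcal{M}\to T\mathcal{M}$ such that a differentiable map $w:[0,T)\to\mathcal{M}$ is a solution of $\dot w=v(w)$ if and only if $z=j\circ w$ is a solution of the DAE, where $j:\mathcal{M}\to\mathbb{R}^d$ is the inclusion. $\mathcal{M}$ is the maximal manifold such that for every $z\in\mathcal{M}$ the set $T_z\mathcal{M}\cap\{w\in\mathbb{R}^d\mid Aw=f(z)\}$ is a singleton. Let $\mathrm{car}(A)=\mathrm{null}(A)^\perp$. A differentiable function $V$ is proper for the DAE if $\nabla V(z)\in\mathrm{car}(A)$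 for every $z\in\mathcal{M}$. $V$ is a dissipated quantity if $\frac{d}{dt}V(z(t))\le0$ for every solution $z$ of the DAE; a proper dissipated quantity is a dissipated quantity that is proper. *)

theory Defs
  imports "HOL-Analysis.Analysis"
begin

(* C^k maps on an open set.  On a finite-dimensional domain, continuity of the
   derivative in operator norm is the same as continuity of all directional
   derivatives, so the recursion runs over the latter. *)

primrec Ck_on :: "nat \<Rightarrow> ('a::euclidean_space \<Rightarrow> 'b::real_normed_vector) \<Rightarrow> 'a set \<Rightarrow> bool" where
  "Ck_on 0 g U \<longleftrightarrow> continuous_on U g"
| "Ck_on (Suc k) g U \<longleftrightarrow>
     (\<forall>x\<in>U. g differentiable (at x)) \<and>
     (\<forall>v. Ck_on k (\<lambda>x. frechet_derivative g (at x) v) U)"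

definition grad :: "('a::euclidean_space \<Rightarrow> real) \<Rightarrow> 'a \<Rightarrow> 'a" where
  "grad V z = (THE D. GDERIV V z :> D)"

(* The four Penrose conditions; A may be singular. *)

definition is_pinv :: "real^'n^'m \<Rightarrow> real^'m^'n \<Rightarrow> bool" where
  "is_pinv A X \<longleftrightarrow>
     A ** X ** A = A \<and> X ** A ** X = X \<and>
     transpose (A ** X) = A ** X \<and> transpose (X ** A) = X ** A"

definition pinv :: "real^'n^'m \<Rightarrow> real^'m^'n" where
  "pinv A = (THE X. is_pinv A X)"

definition neg_semidef :: "real^'n^'n \<Rightarrow> bool" where
  "neg_semidef X \<longleftrightarrow> (\<forall>x. x \<bullet> (X *v x) \<le> 0)"

definition car :: "real^'n^'m \<Rightarrow> (real^'n) set" where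
  "car A = {x. A *v x = 0}\<^sup>\<bottom>"

(* Embedded m-dimensional C^1 submanifolds, by flattening charts: \<phi> is a C^1
   diffeomorphism between open sets of the ambient space, carrying M locally
   onto an open piece of an m-dimensional linear subspace. *)

definition submanifold :: "nat \<Rightarrow> 'a::euclidean_space set \<Rightarrow> bool" where
  "submanifold m M \<longleftrightarrow>
     (\<forall>p\<in>M. \<exists>U W \<phi> \<psi> (L :: 'a set).
        open U \<and> open W \<and> p \<in> U \<and>
        homeomorphism U W \<phi> \<psi> \<and> Ck_on 1 \<phi> U \<and> Ck_on 1 \<psi> W \<and>
        subspace L \<and> dim L = m \<and> \<phi> ` (U \<inter> M) = W \<inter> L)"

definition tangent_space :: "'a::euclidean_space set \<Rightarrow> 'a \<Rightarrow> 'a set" where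
  "tangent_space M z =
     {v. \<exists>\<gamma> e. e > 0 \<and> Ck_on 1 \<gamma> {-e<..<e} \<and> \<gamma> ` {-e<..<e} \<subseteq> M \<and>
            \<gamma> (0::real) = z \<and> (\<gamma> has_vector_derivative v) (at 0)}"

(* Solutions live on [0,T) and have a one-sided derivative at 0.  A map on
   [0,\<infinity>) is a solution iff all its restrictions to [0,T), T finite, are, so
   finite T suffices. *)

definition ode_solution :: "('a::real_normed_vector \<Rightarrow> 'a) \<Rightarrow> real \<Rightarrow> (real \<Rightarrow> 'a) \<Rightarrow> bool" where
  "ode_solution v T w \<longleftrightarrow>
     (\<forall>t\<in>{0..<T}. (w has_vector_derivative v (w t)) (at t within {0..<T}))"

definition dae_solution ::
  "real^'n^'n \<Rightarrow> (real^'n \<Rightarrow> real^'n) \<Rightarrow> real \<Rightarrow> (real \<Rightarrow> real^'n) \<Rightarrow> bool" where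
  "dae_solution A f T z \<longleftrightarrow>
     (\<forall>t\<in>{0..<T}. \<exists>z'. (z has_vector_derivative z') (at t within {0..<T}) \<and> A *v z' = f (z t))"

(* The DAE is equivalent, for maps into M, to the ODE of a vector field on M.
   A vector field is a section of the tangent bundle; no regularity of v is
   imposed. *)

definition reduces_to_ode_on ::
  "real^'n^'n \<Rightarrow> (real^'n \<Rightarrow> real^'n) \<Rightarrow> (real^'n) set \<Rightarrow> bool" where
  "reduces_to_ode_on A f M \<longleftrightarrow>
     (\<exists>v. (\<forall>z\<in>M. v z \<in> tangent_space M z) \<and>
          (\<forall>T>0. \<forall>w. w ` {0..<T} \<subseteq> M \<and> w differentiable_on {0..<T} \<longrightarrow>
             (ode_solution v T w \<longleftrightarrow> dae_solution A f T w)))"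

definition unique_velocity_on ::
  "real^'n^'n \<Rightarrow> (real^'n \<Rightarrow> real^'n) \<Rightarrow> (real^'n) set \<Rightarrow> bool" where
  "unique_velocity_on A f M \<longleftrightarrow>
     (\<forall>z\<in>M. is_singleton (tangent_space M z \<inter> {w. A *v w = f z}))"

(* Maximality is with respect to inclusion.  This is implied by M being the
   largest such manifold. *)

definition regular_dae ::
  "real^'n^'n \<Rightarrow> (real^'n \<Rightarrow> real^'n) \<Rightarrow> (real^'n) set \<Rightarrow> bool" where
  "regular_dae A f M \<longleftrightarrow>
     (\<exists>m. submanifold m M) \<and> reduces_to_ode_on A f M \<and> unique_velocity_on A f M \<and>
     (\<forall>N. (\<exists>m. submanifold m N) \<and> unique_velocity_on A f N \<and> M \<subseteq> N \<longrightarrow> N = M)"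

definition proper_for ::
  "real^'n^'n \<Rightarrow> (real^'n) set \<Rightarrow> (real^'n \<Rightarrow> real) \<Rightarrow> bool" where
  "proper_for A M V \<longleftrightarrow> (\<forall>z. V differentiable (at z)) \<and> (\<forall>z\<in>M. grad V z \<in> car A)"

definition dissipated_quantity ::
  "real^'n^'n \<Rightarrow> (real^'n \<Rightarrow> real^'n) \<Rightarrow> (real^'n \<Rightarrow> real) \<Rightarrow> bool" where
  "dissipated_quantity A f V \<longleftrightarrow>
     (\<forall>T>0. \<forall>z. dae_solution A f T z \<longrightarrow>
        (\<forall>t\<in>{0..<T}. \<exists>D\<le>0. ((\<lambda>s. V (z s)) has_real_derivative D) (at t within {0..<T})))"

end

(* Put g = A^+ f and alpha = <g, grad V>.  Then S = f g^T / alpha satisfies f = S grad V where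
   alpha is nonzero, and A^+ S = g g^T / alpha is negative semidefinite as soon as alpha <= 0.
   For z in M and a solution of the DAE starting at z, grad V(z) in car(A) gives
   alpha(z) = <z', grad V(z)> = (V o z)'(0) <= 0, so the point is that solutions exist although M,
   and hence the vector field on M, need not be smoother than C^1 and C^0.  Since A is injective on
   tangent spaces, a linear image K = B A of z serves as a coordinate on M near z; in this
   coordinate the DAE reads eta' = B f(z(eta)), whose right-hand side is Lipschitz. *)

theory Submission
  imports Defs
begin

section \<open>Calculus of $C^k$ maps\<close>

text \<open>Dissipation is assumed along solutions only, so the sign of alpha at z is unknown until
  some solution starts at z. The obstacle is smoothness: in a C^1 chart \<psi> the ODE contains an
  inverse of the derivative of \<psi>, which is merely continuous, so a contraction argument does
  not apply to it. In the coordinate K only values of \<psi> enter the right-hand side, and these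
  are Lipschitz. A is injective on a tangent space because adding a tangent kernel vector to the
  unique velocity would give a second one. The matrix B of the overview is the map \<open>g\<close>
  in \<open>dae_solution_exists\<close>; K then inverts the derivative of the chart at the initial
  point only, and strict differentiability controls the points nearby. As \<open>g\<close> may fail
  to be injective, the coordinate equation g(A z') = g(f(z)) is weaker than the DAE; the existence
  of a velocity in every tangent space closes this gap.\<close>

lemma Ck_on_SucI:
  fixes g :: "'a::euclidean_space \<Rightarrow> 'b::real_normed_vector"
  assumes "\<And>x. x \<in> U \<Longrightarrow> (g has_derivative g' x) (at x)"
    and "\<And>v. Ck_on k (\<lambda>x. frechet_derivative g (at x) v) U"
  shows "Ck_on (Suc k) g U"
  using assms by (auto simp: differentiable_def)

lemma Ck_on_cong:
  fixes f g :: "'a::euclidean_space \<Rightarrow> 'b::real_normed_vector"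
  assumes "open U" "Ck_on k f U" "\<And>x. x \<in> U \<Longrightarrow> f x = g x"
  shows "Ck_on k g U"
  using assms(2,3)
proof (induction k arbitrary: f g)
  case 0
  then show ?case using continuous_on_cong by force
next
  case (Suc k)
  have der: "(g has_derivative frechet_derivative f (at x)) (at x)" if "x \<in> U" for x
  proof (rule has_derivative_transform_within_open)
    show "(f has_derivative frechet_derivative f (at x)) (at x)"
      using Suc.prems(1) that by (simp add: frechet_derivative_works)
  qed (use assms(1) that Suc.prems(2) in auto)
  show ?case
  proof (rule Ck_on_SucI[OF der])
    fix v
    have "Ck_on k (\<lambda>x. frechet_derivative f (at x) v) U"
      using Suc.prems(1) by simp
    then show "Ck_on k (\<lambda>x. frechet_derivative g (at x) v) U"
      by (rule Suc.IH) (use der frechet_derivative_at in metis)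
  qed
qed

text \<open>Lets an explicit derivative stand in for \<open>frechet_derivative\<close> in the
  recursion; the closure rules below are all inductions through it.\<close>

lemma Ck_on_Suc_has_derivative:
  fixes g :: "'a::euclidean_space \<Rightarrow> 'b::real_normed_vector"
  assumes "open U" "\<And>x. x \<in> U \<Longrightarrow> (g has_derivative g' x) (at x)"
    and "\<And>v. Ck_on k (\<lambda>x. g' x v) U"
  shows "Ck_on (Suc k) g U"
proof (rule Ck_on_SucI[OF assms(2)])
  show "Ck_on k (\<lambda>x. frechet_derivative g (at x) v) U" for v
    by (rule Ck_on_cong[OF assms(1) assms(3)[of v]]) (use assms(2) frechet_derivative_at in metis)
qed

lemma Ck_on_has_derivative:
  assumes "Ck_on (Suc k) g U" "x \<in> U"
  shows "(g has_derivative frechet_derivative g (at x)) (at x)"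
  using assms by (simp add: frechet_derivative_works)

lemma Ck_on_SucD:
  fixes f :: "'a::euclidean_space \<Rightarrow> 'b::real_normed_vector"
  shows "Ck_on (Suc k) f U \<Longrightarrow> Ck_on k f U"
proof (induction k arbitrary: f)
  case 0
  then show ?case
    by (auto intro!: continuous_at_imp_continuous_on differentiable_imp_continuous_within)
next
  case (Suc k)
  have "\<forall>x\<in>U. f differentiable (at x)" using Suc.prems by simp
  moreover have "Ck_on k (\<lambda>x. frechet_derivative f (at x) v) U" for v
    using Suc.prems by (intro Suc.IH) (simp del: Ck_on.simps add: Ck_on.simps(2)[of "Suc k"])
  ultimately show ?case by simp
qed

lemma Ck_on_subset: "Ck_on k f U \<Longrightarrow> W \<subseteq> U \<Longrightarrow> Ck_on k f W"
  by (induction k arbitrary: f) (auto intro: continuous_on_subset)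

lemma Ck_on_bounded_linear:
  fixes f :: "'a::euclidean_space \<Rightarrow> 'b::real_normed_vector"
  assumes U: "open U" and h: "bounded_linear h"
  shows "Ck_on k f U \<Longrightarrow> Ck_on k (\<lambda>x. h (f x)) U"
proof (induction k arbitrary: f)
  case 0
  then show ?case using bounded_linear.continuous_on[OF h] by simp
next
  case (Suc k)
  show ?case
  proof (rule Ck_on_Suc_has_derivative[OF U])
    show "((\<lambda>x. h (f x)) has_derivative (\<lambda>v. h (frechet_derivative f (at x) v))) (at x)"
      if "x \<in> U" for x
      by (rule bounded_linear.has_derivative[OF h Ck_on_has_derivative[OF Suc.prems that]])
    show "Ck_on k (\<lambda>x. h (frechet_derivative f (at x) v)) U" for v
      using Suc.prems by (intro Suc.IH) simp
  qed
qed

lemma Ck_on_add: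
  fixes f g :: "'a::euclidean_space \<Rightarrow> 'b::real_normed_vector"
  assumes U: "open U"
  shows "Ck_on k f U \<Longrightarrow> Ck_on k g U \<Longrightarrow> Ck_on k (\<lambda>x. f x + g x) U"
proof (induction k arbitrary: f g)
  case 0
  then show ?case by (simp add: continuous_on_add)
next
  case (Suc k)
  show ?case
  proof (rule Ck_on_Suc_has_derivative[OF U])
    show "((\<lambda>x. f x + g x) has_derivative
        (\<lambda>v. frechet_derivative f (at x) v + frechet_derivative g (at x) v)) (at x)"
      if "x \<in> U" for x
      by (intro has_derivative_add)
        (rule Ck_on_has_derivative[OF Suc.prems(1) that] Ck_on_has_derivative[OF Suc.prems(2) that])+
    show "Ck_on k (\<lambda>x. frechet_derivative f (at x) v + frechet_derivative g (at x) v) U" for v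
      using Suc.prems by (intro Suc.IH) auto
  qed
qed

lemma Ck_on_sum:
  fixes f :: "'i \<Rightarrow> 'a::euclidean_space \<Rightarrow> 'b::real_normed_vector"
  assumes U: "open U" and "finite I" "I \<noteq> {}" and "\<And>i. i \<in> I \<Longrightarrow> Ck_on k (f i) U"
  shows "Ck_on k (\<lambda>x. \<Sum>i\<in>I. f i x) U"
  using assms(2-) by (induction rule: finite_ne_induct) (auto intro: Ck_on_add[OF U])

lemma Ck_on_bounded_bilinear:
  fixes f :: "'a::euclidean_space \<Rightarrow> 'b::real_normed_vector"
    and g :: "'a \<Rightarrow> 'c::real_normed_vector"
  assumes U: "open U" and h: "bounded_bilinear h"
  shows "Ck_on k f U \<Longrightarrow> Ck_on k g U \<Longrightarrow> Ck_on k (\<lambda>x. h (f x) (g x)) U"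
proof (induction k arbitrary: f g)
  case 0
  then show ?case using bounded_bilinear.continuous_on[OF h] by simp
next
  case (Suc k)
  show ?case
  proof (rule Ck_on_Suc_has_derivative[OF U])
    show "((\<lambda>x. h (f x) (g x)) has_derivative
        (\<lambda>v. h (f x) (frechet_derivative g (at x) v) + h (frechet_derivative f (at x) v) (g x))) (at x)"
      if "x \<in> U" for x
      by (intro bounded_bilinear.FDERIV[OF h])
        (rule Ck_on_has_derivative[OF Suc.prems(1) that] Ck_on_has_derivative[OF Suc.prems(2) that])+
    show "Ck_on k (\<lambda>x. h (f x) (frechet_derivative g (at x) v)
        + h (frechet_derivative f (at x) v) (g x)) U" for v
      \<comment> \<open>The product rule leaves one factor undifferentiated, so each function is
        also needed at the lower order \<open>k\<close>.\<close>
      using Suc.prems Suc.prems[THEN Ck_on_SucD] by (intro Ck_on_add[OF U] Suc.IH) auto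
  qed
qed

lemma Ck_on_inverse:
  fixes f :: "'a::euclidean_space \<Rightarrow> real"
  assumes U: "open U" and nz: "\<And>x. x \<in> U \<Longrightarrow> f x \<noteq> 0"
  shows "Ck_on k f U \<Longrightarrow> Ck_on k (\<lambda>x. inverse (f x)) U"
proof (induction k)
  case 0
  then show ?case using nz by (simp add: continuous_on_inverse)
next
  case (Suc k)
  note mult = Ck_on_bounded_bilinear[OF U bounded_bilinear_mult]
  show ?case
  proof (rule Ck_on_Suc_has_derivative[OF U])
    show "((\<lambda>x. inverse (f x)) has_derivative
        (\<lambda>v. - (inverse (f x) * frechet_derivative f (at x) v * inverse (f x)))) (at x)"
      if "x \<in> U" for x
      by (rule Deriv.has_derivative_inverse[OF nz[OF that] Ck_on_has_derivative[OF Suc.prems that]])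
    \<comment> \<open>The derivative of the reciprocal contains the reciprocal again, one order
      lower, which is what the induction hypothesis covers.\<close>
    have "Ck_on k (\<lambda>x. inverse (f x)) U"
      using Suc.IH Ck_on_SucD[OF Suc.prems] .
    then show "Ck_on k (\<lambda>x. - (inverse (f x) * frechet_derivative f (at x) v * inverse (f x))) U" for v
      using Suc.prems
      by (intro Ck_on_bounded_linear[OF U bounded_linear_minus[OF bounded_linear_ident]] mult) auto
  qed
qed

section \<open>Gradients\<close>

lemma grad_has_derivative:
  fixes V :: "'a::euclidean_space \<Rightarrow> real"
  assumes "V differentiable (at z)"
  shows "(V has_derivative (\<lambda>h. h \<bullet> grad V z)) (at z)"
proof -
  obtain V' where V': "(V has_derivative V') (at z)"
    using assms by (auto simp: differentiable_def)
  \<comment> \<open>The Riesz vector of the functional \<open>V'\<close>, since V' h = <V' h,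
    1>.\<close>
  have "V' = (\<lambda>h. h \<bullet> adjoint V' 1)"
    using adjoint_works[OF has_derivative_linear[OF V']] by auto
  then have D: "GDERIV V z :> adjoint V' 1"
    using V' by (simp add: gderiv_def)
  moreover have "E = adjoint V' 1" if "GDERIV V z :> E" for E
  proof -
    have "(\<lambda>h. h \<bullet> E) = (\<lambda>h. h \<bullet> adjoint V' 1)"
      using that D has_derivative_unique unfolding gderiv_def by blast
    then have "\<forall>h. h \<bullet> E = h \<bullet> adjoint V' 1" by (simp add: fun_eq_iff)
    then show ?thesis by (simp only: vector_eq_ldot)
  qed
  ultimately have "GDERIV V z :> grad V z"
    unfolding grad_def by (rule theI)
  then show ?thesis by (simp add: gderiv_def)
qed

text \<open>\<open>Ck_on\<close> speaks of derivatives in fixed directions, and the basis directions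
  give exactly the coordinates of the gradient.\<close>

lemma Ck_on_grad:
  fixes V :: "'a::euclidean_space \<Rightarrow> real"
  assumes "open U" "Ck_on (Suc k) V U"
  shows "Ck_on k (grad V) U"
proof -
  have "Ck_on k (\<lambda>x. \<Sum>b\<in>Basis. frechet_derivative V (at x) b *\<^sub>R b) U"
    using assms(2)
    by (intro Ck_on_sum assms(1) Ck_on_bounded_linear[OF assms(1) bounded_linear_scaleR_left]) auto
  then show ?thesis
  proof (rule Ck_on_cong[OF assms(1)])
    fix x assume "x \<in> U"
    then have "frechet_derivative V (at x) = (\<lambda>h. h \<bullet> grad V x)"
      using grad_has_derivative[of V x] assms(2) frechet_derivative_at by fastforce
    then show "(\<Sum>b\<in>Basis. frechet_derivative V (at x) b *\<^sub>R b) = grad V x"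
      by (simp add: inner_commute[of _ "grad V x"] euclidean_representation)
  qed
qed

section \<open>The Moore--Penrose inverse\<close>

text \<open>Expansion in an orthonormal basis of \<open>S\<close>. The symmetry clause yields the
  symmetric Penrose conditions and, for charts, that P does not increase norms.\<close>

lemma orthogonal_projection_exists:
  fixes S :: "'a::euclidean_space set"
  assumes "subspace S"
  obtains P where "linear P" "\<And>x. P x \<in> S" "\<And>x. x \<in> S \<Longrightarrow> P x = x"
    "\<And>x y. P x \<bullet> y = x \<bullet> P y"
proof -
  obtain B where B: "B \<subseteq> S" "pairwise orthogonal B" "\<And>x. x \<in> B \<Longrightarrow> norm x = 1"
    "independent B" "span B = S"
    using orthonormal_basis_subspace[OF assms] by metis
  have "finite B" using B(4) independent_imp_finite by blast
  define P where "P x = (\<Sum>b\<in>B. (x \<bullet> b) *\<^sub>R b)" for x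
  have lin: "linear P"
    unfolding P_def
    by (intro linear_compose_sum ballI linearI) (auto simp: inner_add_left scaleR_left_distrib)
  have "P b = b" if "b \<in> B" for b
  proof -
    have "P b = (\<Sum>c\<in>B. if c = b then b else 0)"
      unfolding P_def
    proof (rule sum.cong)
      fix c assume "c \<in> B"
      then show "(b \<bullet> c) *\<^sub>R c = (if c = b then b else 0)"
        using B(2) B(3)[OF that] that
        by (auto simp: pairwise_def orthogonal_def dot_square_norm)
    qed auto
    then show ?thesis using that \<open>finite B\<close> by simp
  qed
  then have "P x = x" if "x \<in> S" for x
    using that linear_eq_on[OF lin linear_id, of x B] B(5) by simp
  moreover have "P x \<in> S" for x
    unfolding P_def using B(1) assms
    by (intro subspace_sum subspace_scale) auto
  moreover have "P x \<bullet> y = x \<bullet> P y" for x y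
    by (simp add: P_def inner_sum_left inner_sum_right mult.commute inner_commute)
  ultimately show thesis using that lin by blast
qed

lemma linear_left_inverse_on_subspace:
  fixes h :: "'a::euclidean_space \<Rightarrow> 'b::euclidean_space"
  assumes "linear h" "subspace L" "\<And>x. x \<in> L \<Longrightarrow> h x = 0 \<Longrightarrow> x = 0"
  obtains g where "linear g" "range g \<subseteq> L" "\<And>x. x \<in> L \<Longrightarrow> g (h x) = x"
proof -
  have span: "span L = L" using assms(2) by (simp add: span_eq_iff)
  have "inj_on h (span L)"
    unfolding span using linear_injective_on_subspace_0[OF assms(1,2)] assms(3) by blast
  from linear_inj_on_left_inverse[OF assms(1) this] show thesis
    using that span by auto
qed

lemma transpose_eqI:
  fixes B :: "real^'n^'n"
  assumes "\<And>x y. (B *v x) \<bullet> y = x \<bullet> (B *v y)"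
  shows "transpose B = B"
  using assms dot_lmul_matrix[of _ B] by (metis matrix_eq vector_eq_rdot transpose_matrix_vector)

text \<open>Transposing AX = (AY)(AX) swaps the symmetric factors, so AX = (AX)(AY) = AY; likewise
  XA = YA. Then X = XAX = YAX = YAY = Y.\<close>

lemma is_pinv_unique:
  assumes "is_pinv A X" "is_pinv A Y"
  shows "X = Y"
proof -
  note X = assms(1)[unfolded is_pinv_def] and Y = assms(2)[unfolded is_pinv_def]
  have "A ** X = transpose (A ** X)" using X by simp
  also have "\<dots> = transpose (A ** Y ** (A ** X))"
    using Y by (simp add: matrix_mul_assoc)
  also have "\<dots> = transpose (A ** X) ** transpose (A ** Y)"
    by (rule matrix_transpose_mul)
  also have "\<dots> = A ** Y"
    using X Y by (simp add: matrix_mul_assoc)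
  finally have 1: "A ** X = A ** Y" .
  have "X ** A = transpose (X ** A)" using X by simp
  also have "\<dots> = transpose (X ** A ** (Y ** A))"
    using Y by (metis matrix_mul_assoc)
  also have "\<dots> = transpose (Y ** A) ** transpose (X ** A)"
    by (rule matrix_transpose_mul)
  also have "\<dots> = Y ** A"
    using X Y by (metis matrix_mul_assoc)
  finally have 2: "X ** A = Y ** A" .
  show ?thesis using X Y 1 2 by (metis matrix_mul_assoc)
qed

lemma subspace_null: "subspace {x. (A::real^'n^'m) *v x = 0}"
  by (auto simp: subspace_def matrix_vector_right_distrib matrix_vector_mult_scaleR)

text \<open>A is injective on the orthogonal complement \<open>C\<close> of its kernel. Project onto
  the range by \<open>Q\<close>, then invert A there with values in \<open>C\<close>. This makes AX
  = Q and XA = I - P, both orthogonal projections.\<close>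

lemma is_pinv_exists:
  fixes A :: "real^'n^'m"
  shows "\<exists>X. is_pinv A X"
proof -
  have lin: "linear ((*v) A)" by simp
  obtain P where P: "linear P" "\<And>x. P x \<in> {x. A *v x = 0}"
    "\<And>x. x \<in> {x. A *v x = 0} \<Longrightarrow> P x = x" "\<And>x y. P x \<bullet> y = x \<bullet> P y"
    using orthogonal_projection_exists[OF subspace_null[of A]] by blast
  obtain Q where Q: "linear Q" "\<And>x. Q x \<in> range ((*v) A)"
    "\<And>x. x \<in> range ((*v) A) \<Longrightarrow> Q x = x" "\<And>x y. Q x \<bullet> y = x \<bullet> Q y"
    using orthogonal_projection_exists[OF linear_subspace_image[OF lin subspace_UNIV]] by blast
  define C where "C = {x. P x = 0}"
  have "subspace C" unfolding C_def by (rule linear_subspace_kernel[OF P(1)])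
  moreover have "x = 0" if "x \<in> C" "A *v x = 0" for x
    using that P(3) by (auto simp: C_def)
  ultimately obtain g where g: "linear g" "range g \<subseteq> C" "\<And>x. x \<in> C \<Longrightarrow> g (A *v x) = x"
    using linear_left_inverse_on_subspace[OF lin] by blast
  define X where "X = matrix (g \<circ> Q)"
  have X: "X *v x = g (Q x)" for x
    unfolding X_def using matrix_vector_mul(2)[OF linear_compose[OF Q(1) g(1)]] by (metis comp_apply)
  have AP: "A *v (x - P x) = A *v x" for x
    using P(2)[of x] by (simp add: matrix_vector_mult_diff_distrib)
  have gA: "g (A *v x) = x - P x" for x
  proof -
    have "x - P x \<in> C" using P by (simp add: C_def linear_diff)
    then show ?thesis using g(3) AP by metis
  qed
  have AX: "A *v (X *v x) = Q x" for x
    using Q(2)[of x] X gA AP by auto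
  have XA: "X *v (A *v x) = x - P x" for x
    using X Q(3) gA by simp
  have "is_pinv A X"
    unfolding is_pinv_def
  proof (intro conjI)
    show "A ** X ** A = A" "X ** A ** X = X"
      using AX XA AP X Q(2,3)
      by (auto simp: matrix_eq matrix_vector_mul_assoc[symmetric])
    show "transpose (A ** X) = A ** X" "transpose (X ** A) = X ** A"
      using AX XA Q(4) P(4)
      by (auto intro!: transpose_eqI simp: matrix_vector_mul_assoc[symmetric] inner_diff)
  qed
  then show ?thesis ..
qed

lemma is_pinv_pinv: "is_pinv A (pinv A)"
  unfolding pinv_def using is_pinv_exists is_pinv_unique by (metis theI)

text \<open>x and its image under \<open>pinv A ** A\<close> differ by a kernel vector of A, which
  is orthogonal to \<open>car A\<close>. This is how properness allows A^+ f to replace the velocity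
  of a solution.\<close>

lemma pinv_mult_car:
  assumes "g \<in> car A"
  shows "(pinv A *v (A *v x)) \<bullet> g = x \<bullet> g"
proof -
  have "A *v (x - pinv A *v (A *v x)) = 0"
    using is_pinv_pinv[of A]
    by (simp add: is_pinv_def matrix_vector_mult_diff_distrib matrix_vector_mul_assoc matrix_mul_assoc)
  then have "(x - pinv A *v (A *v x)) \<bullet> g = 0"
    using assms by (auto simp: car_def orthogonal_comp_def orthogonal_def)
  then show ?thesis by (simp add: inner_diff_left)
qed

section \<open>Rank-one matrices\<close>

definition outer_product :: "real^'m \<Rightarrow> real^'n \<Rightarrow> real^'n^'m" where
  "outer_product u v = (\<chi> i. u $ i *\<^sub>R v)"

lemma bounded_bilinear_outer_product:
  "bounded_bilinear (outer_product :: real^'m \<Rightarrow> real^'n \<Rightarrow> real^'n^'m)"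
  unfolding bilinear_conv_bounded_bilinear[symmetric] bilinear_def
  by (auto intro!: linearI simp: outer_product_def vec_eq_iff algebra_simps)

lemma outer_product_mult: "outer_product u v *v x = (v \<bullet> x) *\<^sub>R u"
  by (simp add: outer_product_def vec_eq_iff matrix_vector_mult_def inner_vec_def
      sum_distrib_left mult_ac)

section \<open>Strict differentiability and the Picard--Lindeloef theorem\<close>

lemma C1_has_derivative:
  assumes "Ck_on 1 g U" "x \<in> U"
  shows "(g has_derivative frechet_derivative g (at x)) (at x)"
  using Ck_on_has_derivative[OF _ assms(2), of 0] assms(1) by (simp only: One_nat_def)

text \<open>Closeness of the derivatives on the finitely many basis vectors gives closeness in
  operator norm; the mean value inequality on the convex ball turns this into the estimate for
  differences. The first bound later makes a derivative injective, the second makes the map itself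
  injective with Lipschitz inverse.\<close>

lemma C1_strictly_differentiable:
  fixes g :: "'a::euclidean_space \<Rightarrow> 'b::real_normed_vector"
  assumes U: "open U" "x0 \<in> U" and g: "Ck_on 1 g U" and "e > 0"
  shows "\<exists>d>0. ball x0 d \<subseteq> U \<and>
    (\<forall>x\<in>ball x0 d. \<forall>h.
      norm (frechet_derivative g (at x) h - frechet_derivative g (at x0) h) \<le> e * norm h) \<and>
    (\<forall>x\<in>ball x0 d. \<forall>y\<in>ball x0 d.
      norm (g x - g y - frechet_derivative g (at x0) (x - y)) \<le> e * norm (x - y))"
proof -
  let ?D = "\<lambda>x. frechet_derivative g (at x)"
  have der: "(g has_derivative ?D x) (at x)" if "x \<in> U" for x
    by (rule C1_has_derivative[OF g that])
  \<comment> \<open>An equal share of \<open>e\<close> for each of the \<open>DIM('a)\<close> basis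
    directions, which are summed below.\<close>
  define e' where "e' = e / DIM('a)"
  have "e' > 0" using \<open>e > 0\<close> by (simp add: e'_def)
  have "eventually (\<lambda>x. dist (?D x b) (?D x0 b) < e') (nhds x0)" for b
  proof -
    have "continuous_on U (\<lambda>x. ?D x b)" using g by simp
    then have "((\<lambda>x. ?D x b) \<longlongrightarrow> ?D x0 b) (nhds x0)"
      using U unfolding continuous_on_eq_continuous_at[OF U(1)] isCont_def
      by (simp add: tendsto_at_iff_tendsto_nhds[of "\<lambda>x. ?D x b" x0, symmetric])
    then show ?thesis using \<open>e' > 0\<close> by (rule tendstoD)
  qed
  then have "eventually (\<lambda>x. \<forall>b\<in>Basis. dist (?D x b) (?D x0 b) < e') (nhds x0)"
    by (intro eventually_ball_finite) auto
  moreover have "eventually (\<lambda>x. x \<in> U) (nhds x0)"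
    using U by (rule eventually_nhds_in_open)
  ultimately have "eventually (\<lambda>x. x \<in> U \<and> (\<forall>b\<in>Basis. dist (?D x b) (?D x0 b) < e')) (nhds x0)"
    by (simp add: eventually_conj)
  then obtain d where d: "d > 0"
    "\<And>x. dist x x0 < d \<Longrightarrow> x \<in> U \<and> (\<forall>b\<in>Basis. dist (?D x b) (?D x0 b) < e')"
    unfolding eventually_nhds_metric by blast
  have sub: "ball x0 d \<subseteq> U"
    using d(2) by (auto simp: dist_commute)
  have close: "norm (?D x h - ?D x0 h) \<le> e * norm h" if x: "x \<in> ball x0 d" for x h
  proof -
    let ?T = "\<lambda>h. ?D x h - ?D x0 h"
    have lin: "linear ?T"
      using der sub x U(2) by (intro linear_compose_sub) (blast intro: has_derivative_linear)+
    have "?T h = (\<Sum>b\<in>Basis. (h \<bullet> b) *\<^sub>R ?T b)"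
      using euclidean_representation[of h] linear_sum[OF lin] linear_scale[OF lin]
      by (metis (no_types, lifting) sum.cong)
    also have "norm \<dots> \<le> (\<Sum>b\<in>(Basis::'a set). norm h * e')"
    proof (rule sum_norm_le)
      fix b :: 'a assume b: "b \<in> Basis"
      have "norm (?T b) \<le> e'"
        using d(2)[of x] x b by (auto simp: dist_norm norm_minus_commute intro: less_imp_le)
      then show "norm ((h \<bullet> b) *\<^sub>R ?T b) \<le> norm h * e'"
        using Basis_le_norm[OF b] by (simp add: mult_mono)
    qed
    also have "\<dots> = e * norm h" by (simp add: e'_def)
    finally show ?thesis .
  qed
  have "norm (g x - g y - ?D x0 (x - y)) \<le> e * norm (x - y)"
    if xy: "x \<in> ball x0 d" "y \<in> ball x0 d" for x y
  proof -
    have lin0: "bounded_linear (?D x0)" using der[OF U(2)] by (rule has_derivative_bounded_linear)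
    \<comment> \<open>Mean value inequality for g minus its linearization at
      \<open>x0\<close>.\<close>
    have "norm ((g x - ?D x0 x) - (g y - ?D x0 y)) \<le> e * norm (x - y)"
    proof (rule differentiable_bound[OF convex_ball _ _ xy])
      fix w assume w: "w \<in> ball x0 d"
      show "((\<lambda>x. g x - ?D x0 x) has_derivative (\<lambda>h. ?D w h - ?D x0 h)) (at w within ball x0 d)"
        using der sub w
        by (intro has_derivative_diff bounded_linear_imp_has_derivative lin0)
          (blast intro: has_derivative_at_withinI)
      show "onorm (\<lambda>h. ?D w h - ?D x0 h) \<le> e"
        using close[OF w] \<open>e > 0\<close> by (intro onorm_bound) auto
    qed
    then show ?thesis
      by (simp add: linear_diff[OF bounded_linear.linear[OF lin0]] algebra_simps)
  qed
  with d(1) sub close show ?thesis by blast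
qed

lemma C1_locally_lipschitz:
  fixes g :: "'a::euclidean_space \<Rightarrow> 'b::real_normed_vector"
  assumes U: "open U" "x0 \<in> U" and g: "Ck_on 1 g U"
  shows "\<exists>d>0. \<exists>C\<ge>0. \<forall>x\<in>ball x0 d. \<forall>y\<in>ball x0 d. norm (g x - g y) \<le> C * norm (x - y)"
proof -
  let ?D = "frechet_derivative g (at x0)"
  obtain d where d: "d > 0" "\<forall>x\<in>ball x0 d. \<forall>y\<in>ball x0 d.
      norm (g x - g y - ?D (x - y)) \<le> 1 * norm (x - y)"
    using C1_strictly_differentiable[OF U g zero_less_one] by blast
  have "bounded_linear ?D"
    by (rule has_derivative_bounded_linear[OF C1_has_derivative[OF g U(2)]])
  then obtain C where C: "C \<ge> 0" "\<And>x. norm (?D x) \<le> norm x * C"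
    using bounded_linear.nonneg_bounded by blast
  have "norm (g x - g y) \<le> (1 + C) * norm (x - y)" if "x \<in> ball x0 d" "y \<in> ball x0 d" for x y
    using bspec[OF bspec[OF d(2) that(1)] that(2)] C(2)[of "x - y"] norm_triangle_sub[of "g x - g y" "?D (x - y)"]
    by (simp add: algebra_simps)
  moreover have "1 + C \<ge> 0" using C(1) by simp
  ultimately show ?thesis using d(1) by blast
qed

text \<open>The Banach fixed point theorem is applied on the complete space of bounded continuous
  functions on the whole line. Hence \<open>F\<close> is extended to \<open>G\<close> by the
  nonexpansive closest-point map of the ball, and time is clamped to [0,T]. The fixed point never
  leaves the ball, so \<open>G\<close> agrees with \<open>F\<close> along it.\<close>

lemma picard_lindeloef:
  fixes F :: "'a::euclidean_space \<Rightarrow> 'a"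
  assumes R: "R > 0" and K: "K \<ge> 0"
    and lip: "\<And>x y. x \<in> cball x0 R \<Longrightarrow> y \<in> cball x0 R \<Longrightarrow> norm (F x - F y) \<le> K * norm (x - y)"
  obtains T \<eta> where "T > 0" "\<eta> 0 = x0"
    "\<And>t. t \<in> {0..T} \<Longrightarrow> \<eta> t \<in> cball x0 R"
    "\<And>t. t \<in> {0..T} \<Longrightarrow> (\<eta> has_vector_derivative F (\<eta> t)) (at t within {0..T})"
proof -
  define cp where "cp = closest_point (cball x0 R)"
  define G where "G x = F (cp x)" for x
  have ne: "cball x0 R \<noteq> {}" using R by auto
  have cp_in: "cp x \<in> cball x0 R" for x
    unfolding cp_def using ne by (intro closest_point_in_set) auto
  have G_lip: "norm (G x - G y) \<le> K * norm (x - y)" for x y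
  proof -
    have "norm (cp x - cp y) \<le> norm (x - y)"
      using closest_point_lipschitz[of "cball x0 R" x y] ne by (simp add: cp_def dist_norm)
    then have "K * norm (cp x - cp y) \<le> K * norm (x - y)" using K by (rule mult_left_mono)
    then show ?thesis using lip[OF cp_in cp_in] unfolding G_def by (rule order_trans[rotated])
  qed
  define B where "B = norm (F x0) + K * R"
  have B: "B \<ge> 0" using K R by (simp add: B_def)
  have G_bound: "norm (G x) \<le> B" for x
  proof -
    have "norm (F (cp x) - F x0) \<le> K * norm (cp x - x0)"
      using lip[OF cp_in, of x0] R by simp
    also have "\<dots> \<le> K * R"
      using cp_in[of x] K by (intro mult_left_mono) (auto simp: dist_norm norm_minus_commute)
    finally show ?thesis
      using norm_triangle_sub[of "F (cp x)" "F x0"] by (simp add: G_def B_def)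
  qed
  have "K-lipschitz_on UNIV G"
    using G_lip K by (intro lipschitz_onI) (auto simp: dist_norm)
  then have G_cont: "continuous_on UNIV G" by (rule lipschitz_on_continuous_on)
  have Gy_cont: "continuous_on S (\<lambda>s. G (apply_bcontfun y s))" for S and y :: "real \<Rightarrow>\<^sub>C 'a"
    using continuous_on_compose2[OF G_cont continuous_on_apply_bcontfun] by blast
  \<comment> \<open>The first bound makes the integral operator a 1/2-contraction, the second keeps
    its values within distance \<open>R\<close> of \<open>x0\<close>. The summands 1 keep the
    denominators positive when \<open>K\<close> or \<open>B\<close> is 0.\<close>
  define T where "T = min (1 / (2 * (K + 1))) (R / (B + 1))"
  have T: "T > 0" using K R B by (simp add: T_def)
  have "T * K \<le> (1 / (2 * (K + 1))) * K" using K by (intro mult_right_mono) (auto simp: T_def)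
  also have "\<dots> \<le> 1/2" using K by (simp add: field_simps)
  finally have TK: "T * K \<le> 1/2" .
  have "T * B \<le> (R / (B + 1)) * B" using B by (intro mult_right_mono) (auto simp: T_def)
  also have "\<dots> \<le> R" using B R by (simp add: field_simps)
  finally have TB: "T * B \<le> R" .
  define c where "c t = max 0 (min t T)" for t
  have c: "0 \<le> c t" "c t \<le> T" for t using T by (auto simp: c_def)
  define I where "I y t = x0 + integral {0..c t} (\<lambda>s. G (apply_bcontfun y s))" for y :: "real \<Rightarrow>\<^sub>C 'a" and t
  have I_bound: "norm (I y t - x0) \<le> R" for y t
  proof -
    have "norm (integral {0..c t} (\<lambda>s. G (apply_bcontfun y s))) \<le> B * (c t - 0)"
      by (rule integral_bound[OF c(1) Gy_cont G_bound])
    also have "\<dots> \<le> B * T" using c B by (simp add: mult_left_mono)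
    finally show ?thesis using TB by (simp add: I_def mult.commute)
  qed
  have I_cont: "continuous_on UNIV (I y)" for y
  proof -
    have "continuous_on {0..T} (\<lambda>u. integral {0..u} (\<lambda>s. G (apply_bcontfun y s)))"
      by (intro indefinite_integral_continuous_1 integrable_continuous_real Gy_cont)
    moreover have "continuous_on UNIV c" unfolding c_def by (intro continuous_intros)
    ultimately have "continuous_on UNIV (\<lambda>t. integral {0..c t} (\<lambda>s. G (apply_bcontfun y s)))"
      by (rule continuous_on_compose2) (use c in auto)
    then show ?thesis unfolding I_def by (intro continuous_intros)
  qed
  have "I y \<in> bcontfun" for y
  proof (rule bcontfun_normI[OF I_cont])
    show "norm (I y t) \<le> norm x0 + R" for t
      using I_bound[of y t] norm_triangle_sub[of "I y t" x0] by simp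
  qed
  then have app: "apply_bcontfun (Bcontfun (I y)) = I y" for y
    by (rule Bcontfun_inverse)
  have "dist (Bcontfun (I y)) (Bcontfun (I w)) \<le> 1/2 * dist y w" for y w
  proof (rule dist_bound)
    fix t
    have "I y t - I w t = integral {0..c t} (\<lambda>s. G (apply_bcontfun y s) - G (apply_bcontfun w s))"
      unfolding I_def by (subst integral_diff) (auto intro: integrable_continuous_real Gy_cont)
    also have "norm \<dots> \<le> K * dist y w * (c t - 0)"
    proof (rule integral_bound[OF c(1)])
      show "continuous_on {0..c t} (\<lambda>s. G (apply_bcontfun y s) - G (apply_bcontfun w s))"
        by (intro continuous_on_diff Gy_cont)
      fix s
      have "K * norm (apply_bcontfun y s - apply_bcontfun w s) \<le> K * dist y w"
        using dist_bounded[of y s w] K by (intro mult_left_mono) (auto simp: dist_norm)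
      then show "norm (G (apply_bcontfun y s) - G (apply_bcontfun w s)) \<le> K * dist y w"
        using G_lip order_trans by blast
    qed
    also have "\<dots> \<le> K * dist y w * T" using c K by (intro mult_left_mono) auto
    also have "\<dots> = (T * K) * dist y w" by simp
    also have "\<dots> \<le> 1/2 * dist y w" using TK by (intro mult_right_mono) auto
    finally show "dist (apply_bcontfun (Bcontfun (I y)) t) (apply_bcontfun (Bcontfun (I w)) t) \<le> 1/2 * dist y w"
      by (simp add: app dist_norm)
  qed
  then have "\<forall>y w. dist (Bcontfun (I y)) (Bcontfun (I w)) \<le> 1/2 * dist y w" by blast
  then have "\<exists>!y. Bcontfun (I y) = y" by (intro banach_fix_type[of "1/2"]) auto
  then obtain y where "Bcontfun (I y) = y" by blast
  then have y: "apply_bcontfun y t = I y t" for t using app[of y] by simp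
  show thesis
  proof (rule that[OF T])
    show "apply_bcontfun y 0 = x0" using T y[of 0] by (simp add: I_def c_def)
    fix t assume t: "t \<in> {0..T}"
    show in_ball: "apply_bcontfun y t \<in> cball x0 R"
      using I_bound[of y t] y[of t] by (simp add: dist_norm norm_minus_commute)
    then have "G (apply_bcontfun y t) = F (apply_bcontfun y t)"
      by (simp add: G_def cp_def closest_point_self)
    moreover have "((\<lambda>u. x0 + integral {0..u} (\<lambda>s. G (apply_bcontfun y s)))
        has_vector_derivative 0 + G (apply_bcontfun y t)) (at t within {0..T})"
      by (intro has_vector_derivative_add has_vector_derivative_const
          integral_has_vector_derivative Gy_cont t)
    ultimately have "((\<lambda>u. x0 + integral {0..u} (\<lambda>s. G (apply_bcontfun y s)))
        has_vector_derivative F (apply_bcontfun y t)) (at t within {0..T})"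
      by simp
    then show "(apply_bcontfun y has_vector_derivative F (apply_bcontfun y t)) (at t within {0..T})"
    proof (rule has_vector_derivative_transform[OF t, rotated])
      fix u assume "u \<in> {0..T}"
      then show "apply_bcontfun y u = x0 + integral {0..u} (\<lambda>s. G (apply_bcontfun y s))"
        using y[of u] by (simp only: I_def c_def) (simp add: max_def min_def)
    qed
  qed
qed

section \<open>Solutions of the DAE\<close>

text \<open>Segments in L through y, mapped by \<psi>, realize every vector of the right side.
  Conversely, a curve in M becomes under \<phi> a curve in L near time 0, so its velocity there lies
  in L, and the derivative of \<psi> carries it back.\<close>

lemma tangent_space_chart:
  fixes M :: "'a::euclidean_space set"
  assumes U: "open U" and W: "open W" and hom: "homeomorphism U W \<phi> \<psi>"
    and \<phi>: "Ck_on 1 \<phi> U" and \<psi>: "Ck_on 1 \<psi> W"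
    and L: "subspace L" and flat: "\<phi> ` (U \<inter> M) = W \<inter> L"
    and y: "y \<in> W \<inter> L"
  shows "tangent_space M (\<psi> y) = frechet_derivative \<psi> (at y) ` L"
proof -
  let ?D = "\<lambda>y. frechet_derivative \<psi> (at y)"
  have der: "(\<psi> has_derivative ?D x) (at x)" if "x \<in> W" for x
    by (rule C1_has_derivative[OF \<psi> that])
  have \<psi>\<phi>: "\<psi> (\<phi> x) = x" if "x \<in> U" for x
    using hom that by (simp add: homeomorphism_def)
  have \<phi>\<psi>: "\<phi> (\<psi> x) = x" if "x \<in> W" for x
    using hom that by (simp add: homeomorphism_def)
  have \<psi>U: "\<psi> x \<in> U" if "x \<in> W" for x
    using hom that by (auto simp: homeomorphism_def)
  have \<psi>M: "\<psi> x \<in> M" if "x \<in> W \<inter> L" for x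
    using that flat \<psi>\<phi> by (smt (verit, best) Int_iff imageE)
  have "?D y l \<in> tangent_space M (\<psi> y)" if l: "l \<in> L" for l
  proof -
    obtain d where d: "d > 0" "ball y d \<subseteq> W"
      using W y open_contains_ball by blast
    \<comment> \<open>Ensures |s| norm l < d for |s| < e, also when \<open>l\<close> is 0.\<close>
    define e where "e = d / (norm l + 1)"
    have e: "e > 0" using d by (simp add: e_def add_nonneg_pos)
    have line: "y + s *\<^sub>R l \<in> W \<inter> L" if s: "s \<in> {-e<..<e}" for s
    proof -
      have "\<bar>s\<bar> * norm l \<le> \<bar>s\<bar> * (norm l + 1)" by (simp add: algebra_simps)
      also have "\<dots> < e * (norm l + 1)" using s by (intro mult_strict_right_mono) (auto simp: add_nonneg_pos)
      also have "\<dots> = d" using norm_ge_zero[of l] by (simp add: e_def add_nonneg_eq_0_iff)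
      finally have "y + s *\<^sub>R l \<in> W" using d(2) by (auto simp: dist_norm)
      then show ?thesis using y l L by (auto intro: subspace_add subspace_scale)
    qed
    define \<gamma> where "\<gamma> s = \<psi> (y + s *\<^sub>R l)" for s
    have \<gamma>': "(\<gamma> has_derivative (\<lambda>h. ?D (y + s *\<^sub>R l) (h *\<^sub>R l))) (at s)" if "s \<in> {-e<..<e}" for s
    proof -
      have "((\<lambda>s. y + s *\<^sub>R l) has_derivative (\<lambda>h. h *\<^sub>R l)) (at s)"
        by (auto intro!: derivative_eq_intros)
      then show ?thesis
        unfolding \<gamma>_def using has_derivative_compose der line[OF that] by blast
    qed
    have "Ck_on (Suc 0) \<gamma> {-e<..<e}"
    proof (rule Ck_on_Suc_has_derivative[OF open_greaterThanLessThan \<gamma>'])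
      fix v :: real
      have "continuous_on W (\<lambda>x. ?D x (v *\<^sub>R l))" using \<psi> by simp
      then have "continuous_on {-e<..<e} (\<lambda>s. ?D (y + s *\<^sub>R l) (v *\<^sub>R l))"
        by (rule continuous_on_compose2) (use line in \<open>auto intro!: continuous_intros\<close>)
      then show "Ck_on 0 (\<lambda>s. ?D (y + s *\<^sub>R l) (v *\<^sub>R l)) {-e<..<e}" by simp
    qed
    moreover have "\<gamma> ` {-e<..<e} \<subseteq> M" using line \<psi>M by (auto simp: \<gamma>_def)
    moreover have "(\<gamma> has_vector_derivative ?D y l) (at 0)"
      using \<gamma>'[of 0] e der[of y] y linear_scale[OF has_derivative_linear]
      by (fastforce simp: has_vector_derivative_def)
    moreover have "\<gamma> 0 = \<psi> y" by (simp add: \<gamma>_def)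
    ultimately show ?thesis using e unfolding tangent_space_def by auto
  qed
  moreover have "u \<in> ?D y ` L" if "u \<in> tangent_space M (\<psi> y)" for u
  proof -
    obtain \<gamma> e where \<gamma>: "e > 0" "\<gamma> ` {-e<..<e} \<subseteq> M" "\<gamma> 0 = \<psi> y"
      "(\<gamma> has_vector_derivative u) (at (0::real))"
      using \<open>u \<in> tangent_space M (\<psi> y)\<close> unfolding tangent_space_def by auto
    let ?E = "frechet_derivative \<phi> (at (\<psi> y))"
    have E: "(\<phi> has_derivative ?E) (at (\<psi> y))"
      using C1_has_derivative[OF \<phi> \<psi>U] y by blast
    have "\<phi> (\<psi> y) = y" using \<phi>\<psi> y by simp
    then have "((\<lambda>x. \<psi> (\<phi> x)) has_derivative (\<lambda>h. ?D y (?E h))) (at (\<psi> y))"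
      using has_derivative_compose[OF E] der y by (metis IntD1)
    moreover have "((\<lambda>x. \<psi> (\<phi> x)) has_derivative (\<lambda>h. h)) (at (\<psi> y))"
      by (rule has_derivative_transform_within_open[OF has_derivative_ident U])
        (use \<psi>U \<psi>\<phi> y in auto)
    ultimately have DE: "?D y (?E h) = h" for h
      using has_derivative_unique by metis
    obtain P where P: "linear P" "\<And>x. P x \<in> L" "\<And>x. x \<in> L \<Longrightarrow> P x = x"
      by (rule orthogonal_projection_exists[OF L]) blast
    have "((\<lambda>s. \<phi> (\<gamma> s)) has_vector_derivative ?E u) (at 0)"
      using vector_derivative_diff_chain_within[OF \<gamma>(4), of \<phi> ?E] E \<gamma>(3)
      by (auto simp: comp_def intro: has_derivative_at_withinI)
    then have 1: "((\<lambda>s. P (\<phi> (\<gamma> s))) has_vector_derivative P (?E u)) (at 0)"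
      and 2: "((\<lambda>s. \<phi> (\<gamma> s)) has_vector_derivative ?E u) (at 0)"
      using bounded_linear.has_vector_derivative P(1) by (auto simp: linear_conv_bounded_linear)
    have "isCont \<gamma> 0" using \<gamma>(4) by (rule has_vector_derivative_continuous)
    then have "eventually (\<lambda>s. \<gamma> s \<in> U) (nhds 0)"
      unfolding isCont_def tendsto_at_iff_tendsto_nhds
      using U \<psi>U y \<gamma>(3) by (intro topological_tendstoD) auto
    then obtain d where d: "d > 0" "\<And>s. dist s 0 < d \<Longrightarrow> \<gamma> s \<in> U"
      unfolding eventually_nhds_metric by blast
    \<comment> \<open>Near 0 the curve is fixed by \<open>P\<close>, so its derivative is fixed by
      \<open>P\<close> too and hence lies in \<open>L\<close>.\<close>
    have "((\<lambda>s. \<phi> (\<gamma> s)) has_vector_derivative P (?E u)) (at 0)"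
    proof (rule has_vector_derivative_transform_within_open[OF 1])
      show "open {-min d e<..<min d e}" "0 \<in> {-min d e<..<min d e}" using d \<gamma>(1) by auto
      fix s assume "s \<in> {-min d e<..<min d e}"
      then have "\<gamma> s \<in> U \<inter> M" using d(2)[of s] \<gamma>(2) by (auto simp: dist_norm)
      then have "\<phi> (\<gamma> s) \<in> L" using flat by blast
      then show "P (\<phi> (\<gamma> s)) = \<phi> (\<gamma> s)" by (rule P(3))
    qed
    then have "P (?E u) = ?E u" using 2 vector_derivative_unique_at by blast
    then have "?E u \<in> L" using P(2) by metis
    then show ?thesis using DE by (metis image_eqI)
  qed
  ultimately show ?thesis by blast
qed

lemma dae_solution_exists:
  fixes A :: "real^'d^'d" and f :: "real^'d \<Rightarrow> real^'d"
  assumes f: "Ck_on 1 f UNIV" and M: "submanifold m M"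
    and uniq: "unique_velocity_on A f M" and z0: "z0 \<in> M"
  obtains T z where "T > 0" "dae_solution A f T z" "z 0 = z0"
proof -
  obtain U W \<phi> \<psi> and L :: "(real^'d) set" where U: "open U" and W: "open W" and z0U: "z0 \<in> U"
    and hom: "homeomorphism U W \<phi> \<psi>" and \<phi>: "Ck_on 1 \<phi> U" and \<psi>: "Ck_on 1 \<psi> W"
    and L: "subspace L" and flat: "\<phi> ` (U \<inter> M) = W \<inter> L"
    using bspec[OF M[unfolded submanifold_def] z0] by (elim exE conjE) (rule that)
  let ?D = "\<lambda>y. frechet_derivative \<psi> (at y)"
  note tangent = tangent_space_chart[OF U W hom \<phi> \<psi> L flat]
  have D: "(\<psi> has_derivative ?D x) (at x)" if "x \<in> W" for x
    by (rule C1_has_derivative[OF \<psi> that])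
  define y0 where "y0 = \<phi> z0"
  have y0: "y0 \<in> W" "y0 \<in> L" using flat z0 z0U by (auto simp: y0_def)
  have \<psi>y0: "\<psi> y0 = z0" using hom z0U by (simp add: homeomorphism_def y0_def)
  have \<phi>\<psi>: "\<phi> (\<psi> x) = x" if "x \<in> W" for x
    using hom that by (simp add: homeomorphism_def)
  have \<psi>\<phi>: "\<psi> (\<phi> x) = x" if "x \<in> U" for x
    using hom that by (simp add: homeomorphism_def)
  have \<psi>M: "\<psi> x \<in> M" if "x \<in> W" "x \<in> L" for x
    using that flat \<psi>\<phi> by (smt (verit, best) Int_iff imageE)
  have linD0: "linear (?D y0)" using D[OF y0(1)] by (rule has_derivative_linear)

  obtain P where P: "linear P" "\<And>x. P x \<in> L" "\<And>x. x \<in> L \<Longrightarrow> P x = x"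
    "\<And>x y. P x \<bullet> y = x \<bullet> P y"
    by (rule orthogonal_projection_exists[OF L]) blast
  have P_norm: "norm (P x) \<le> norm x" for x
  proof -
    have "norm (P x) * norm (P x) = x \<bullet> P x"
      using P(2,3,4) by (metis norm_eq_square power2_eq_square dot_square_norm)
    also have "\<dots> \<le> norm x * norm (P x)" by (rule norm_cauchy_schwarz)
    finally show ?thesis by (cases "P x = 0") auto
  qed

  have D_inj: "l = 0" if "l \<in> L" "?D y0 l = 0" for l
  proof -
    have E: "(\<phi> has_derivative frechet_derivative \<phi> (at z0)) (at z0)"
      by (rule C1_has_derivative[OF \<phi> z0U])
    have "((\<lambda>x. \<phi> (\<psi> x)) has_derivative (\<lambda>h. frechet_derivative \<phi> (at z0) (?D y0 h))) (at y0)"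
      using has_derivative_compose[OF D[OF y0(1)]] E \<psi>y0 by metis
    moreover have "((\<lambda>x. \<phi> (\<psi> x)) has_derivative (\<lambda>h. h)) (at y0)"
      by (rule has_derivative_transform_within_open[OF has_derivative_ident W y0(1)])
        (use \<phi>\<psi> in auto)
    ultimately have "frechet_derivative \<phi> (at z0) (?D y0 l) = l"
      using has_derivative_unique by metis
    then show "l = 0" using that(2) linear_0[OF has_derivative_linear[OF E]] by simp
  qed
  have "linear (\<lambda>l. A *v ?D y0 l)"
    using linear_compose[OF linD0, of "(*v) A"] by (simp add: comp_def)
  \<comment> \<open>Otherwise w and w plus the image of \<open>l\<close> would be two velocities at
    \<open>z0\<close>.\<close>
  moreover have "l = 0" if l: "l \<in> L" "A *v ?D y0 l = 0" for l
  proof -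
    obtain w where w: "tangent_space M z0 \<inter> {w. A *v w = f z0} = {w}"
      using uniq z0 unfolding unique_velocity_on_def is_singleton_def by blast
    then obtain l0 where l0: "l0 \<in> L" "w = ?D y0 l0"
      using tangent[of y0] y0 \<psi>y0 by blast
    have "?D y0 (l0 + l) \<in> tangent_space M z0"
      using tangent[of y0] y0 \<psi>y0 l(1) l0(1) L by (auto intro: subspace_add)
    moreover have "?D y0 (l0 + l) = w + ?D y0 l" using l0 linear_add[OF linD0] by simp
    moreover have "A *v (w + ?D y0 l) = f z0"
      using w l(2) by (auto simp: matrix_vector_right_distrib)
    ultimately have "w + ?D y0 l \<in> {w}" using w by (metis IntI mem_Collect_eq)
    then have "w + ?D y0 l = w" by (rule singletonD)
    then show "l = 0" using D_inj[OF l(1)] by simp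
  qed
  ultimately obtain g where g: "linear g" "range g \<subseteq> L" "\<And>l. l \<in> L \<Longrightarrow> g (A *v ?D y0 l) = l"
    using linear_left_inverse_on_subspace L by blast
  \<comment> \<open>On \<open>L\<close>, \<open>K\<close> inverts the derivative of \<psi> at
    \<open>y0\<close>, so K(\<psi>(y)) has the identity of \<open>L\<close> as derivative
    there.\<close>
  define K where "K x = g (A *v x)" for x
  have K: "linear K" unfolding K_def using linear_compose[OF _ g(1), of "(*v) A"] by (simp add: comp_def)
  have KL: "K x \<in> L" for x using g(2) by (auto simp: K_def)
  have KD: "K (?D y0 l) = l" if "l \<in> L" for l using g(3)[OF that] by (simp add: K_def)
  obtain k where k: "k > 0" "\<And>x. norm (K x) \<le> norm x * k"
    using bounded_linear.pos_bounded K by (metis linear_conv_bounded_linear)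
  obtain kg where kg: "kg > 0" "\<And>x. norm (g x) \<le> norm x * kg"
    using bounded_linear.pos_bounded g(1) by (metis linear_conv_bounded_linear)

  \<comment> \<open>Since \<open>K\<close> magnifies by at most \<open>k\<close>, this tolerance
    leaves an error of at most one half after applying \<open>K\<close>.\<close>
  have "1 / (2 * k) > 0" using k(1) by simp
  from C1_strictly_differentiable[OF W y0(1) \<psi> this]
  obtain d0 where d0: "d0 > 0" "ball y0 d0 \<subseteq> W"
    and Dclose: "\<forall>x\<in>ball y0 d0. \<forall>h. norm (?D x h - ?D y0 h) \<le> 1 / (2 * k) * norm h"
    and \<psi>close: "\<forall>x\<in>ball y0 d0. \<forall>y\<in>ball y0 d0.
      norm (\<psi> x - \<psi> y - ?D y0 (x - y)) \<le> 1 / (2 * k) * norm (x - y)"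
    by blast
  obtain d1 C1 where d1: "d1 > 0" "C1 \<ge> 0"
    "\<forall>x\<in>ball y0 d1. \<forall>y\<in>ball y0 d1. norm (\<psi> x - \<psi> y) \<le> C1 * norm (x - y)"
    using C1_locally_lipschitz[OF W y0(1) \<psi>] by blast
  obtain d2 C2 where d2: "d2 > 0" "C2 \<ge> 0"
    "\<forall>x\<in>ball z0 d2. \<forall>y\<in>ball z0 d2. norm (f x - f y) \<le> C2 * norm (x - y)"
    using C1_locally_lipschitz[OF open_UNIV UNIV_I f] by blast
  \<comment> \<open>The last bound makes \<psi> map the ball into the region where \<open>f\<close>
    is Lipschitz.\<close>
  define d where "d = min (min d0 d1) (d2 / (C1 + 1))"
  have d: "d > 0" "d \<le> d0" "d \<le> d1"
    using d0(1) d1(1,2) d2(1) by (auto simp: d_def)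
  have "d \<le> d2 / (C1 + 1)" by (simp add: d_def)
  then have d_le: "d * (C1 + 1) \<le> d2" using d1(2) by (simp add: pos_le_divide_eq)
  define B where "B = ball y0 d"
  have y0B: "y0 \<in> B" using d by (simp add: B_def)
  have B: "x \<in> W" "x \<in> ball y0 d0" "x \<in> ball y0 d1" "\<psi> x \<in> ball z0 d2" if x: "x \<in> B" for x
  proof -
    show 1: "x \<in> ball y0 d0" "x \<in> ball y0 d1" using x d by (auto simp: B_def)
    then show "x \<in> W" using d0(2) by blast
    have "norm (\<psi> x - \<psi> y0) \<le> C1 * norm (x - y0)" using d1 1 by simp
    also have "\<dots> \<le> (C1 + 1) * norm (x - y0)" by (simp add: mult_right_mono)
    also have "\<dots> < (C1 + 1) * d"
      using x d1(2) by (intro mult_strict_left_mono) (auto simp: B_def dist_norm norm_minus_commute)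
    finally show "\<psi> x \<in> ball z0 d2" using d_le \<psi>y0 by (simp add: dist_norm norm_minus_commute mult.commute)
  qed
  have PB: "P x \<in> B" if "x \<in> B" for x
  proof -
    have "P x - y0 = P (x - y0)" using P(1,3) y0(2) by (simp add: linear_diff)
    then show ?thesis using P_norm[of "x - y0"] that
      by (simp add: B_def dist_commute[of y0]) (simp add: dist_norm)
  qed

  \<comment> \<open>G extends the coordinate \<open>K \<circ> \<psi>\<close> from L to the ambient space, preserves L, and has the
    identity as derivative at y0, so its inverse H solves \<open>K (\<psi> y) = \<eta>\<close> for y in L.\<close>
  define G where "G y = K (\<psi> (P y)) + (y - P y)" for y
  define G' where "G' y h = K (?D (P y) (P h)) + (h - P h)" for y h
  have G_der: "(G has_derivative G' y) (at y)" if "y \<in> B" for y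
  proof -
    have P': "(P has_derivative P) (at y)"
      using P(1) by (simp add: linear_imp_has_derivative)
    have "((\<lambda>y. \<psi> (P y)) has_derivative (\<lambda>h. ?D (P y) (P h))) (at y)"
      by (rule has_derivative_compose[OF P' D[OF B(1)[OF PB[OF that]]]])
    then have "((\<lambda>y. K (\<psi> (P y))) has_derivative (\<lambda>h. K (?D (P y) (P h)))) (at y)"
      by (rule bounded_linear.has_derivative[OF K[unfolded linear_conv_bounded_linear]])
    then show ?thesis
      unfolding G_def[abs_def] G'_def[abs_def]
      by (rule has_derivative_add[OF _ has_derivative_diff[OF has_derivative_ident P']])
  qed
  have K_half: "norm (K x) \<le> 1/2 * norm h" if "norm x \<le> 1 / (2 * k) * norm (P h)" for x h
  proof -
    have "norm (K x) \<le> norm x * k" by (rule k(2))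
    also have "\<dots> \<le> (1 / (2 * k) * norm (P h)) * k" using that k(1) by (intro mult_right_mono) auto
    also have "\<dots> \<le> 1/2 * norm h" using k(1) P_norm[of h] by simp
    finally show ?thesis .
  qed
  \<comment> \<open>\<open>G' y\<close> differs from the identity by at most 1/2 in norm.\<close>
  have G'_inj: "h = 0" if y: "y \<in> B" and h: "G' y h = 0" for y h
  proof -
    have "G' y h - h = K (?D (P y) (P h) - ?D y0 (P h))"
      using KD[OF P(2)] K by (simp add: G'_def linear_diff)
    then have "norm (G' y h - h) \<le> 1/2 * norm h"
      using K_half bspec[OF Dclose B(2)[OF PB[OF y]]] by simp
    then show "h = 0" using h by simp
  qed
  \<comment> \<open>\<open>G\<close> minus the identity is a 1/2-contraction, whence the factor
    2.\<close>
  have G_inv_lip: "norm (x - y) \<le> 2 * norm (G x - G y)" if xy: "x \<in> B" "y \<in> B" for x y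
  proof -
    have "G x - G y - (x - y) = K (\<psi> (P x) - \<psi> (P y) - ?D y0 (P (x - y)))"
      using KD[OF P(2), of "x - y"] K P(1) by (simp add: G_def linear_diff)
    moreover have "norm (\<psi> (P x) - \<psi> (P y) - ?D y0 (P (x - y))) \<le> 1 / (2 * k) * norm (P (x - y))"
      using bspec[OF bspec[OF \<psi>close B(2)[OF PB[OF xy(1)]]] B(2)[OF PB[OF xy(2)]]] P(1)
      by (simp add: linear_diff)
    ultimately have "norm (G x - G y - (x - y)) \<le> 1/2 * norm (x - y)"
      using K_half by simp
    then show ?thesis using norm_triangle_sub[of "x - y" "G x - G y"]
      by (simp add: norm_minus_commute)
  qed
  have inj: "inj_on G B"
    using G_inv_lip by (intro inj_onI) fastforce
  have G_cont: "continuous_on B G"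
    using G_der has_derivative_continuous continuous_at_imp_continuous_on by blast
  have "open (G ` B)"
    using invariance_of_domain[OF G_cont _ inj] by (simp add: B_def)
  then obtain R where R: "R > 0" "cball (G y0) R \<subseteq> G ` B"
    using y0B open_contains_cball by (metis image_eqI)
  define H where "H = inv_into B G"
  have HB: "H \<eta> \<in> B" "G (H \<eta>) = \<eta>" if "\<eta> \<in> cball (G y0) R" for \<eta>
    using that R(2) by (auto simp: H_def inv_into_into f_inv_into_f subset_iff)
  have HG: "H (G y) = y" if "y \<in> B" for y
    using that inj by (simp add: H_def)

  \<comment> \<open>From \<eta> = K z and A z' = f(z) follows \<eta>' = g(A z') = g(f(z)), with z
    recovered as \<psi>(P(H \<eta>)). The Lipschitz constant is the product of those of
    \<open>H\<close>, \<psi>, \<open>f\<close> and \<open>g\<close>.\<close>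
  define F where "F \<eta> = g (f (\<psi> (P (H \<eta>))))" for \<eta>
  have FL: "F \<eta> \<in> L" for \<eta> using g(2) by (auto simp: F_def)
  have F_lip: "norm (F \<eta> - F \<xi>) \<le> (2 * C1 * C2 * kg) * norm (\<eta> - \<xi>)"
    if mem: "\<eta> \<in> cball (G y0) R" "\<xi> \<in> cball (G y0) R" for \<eta> \<xi>
  proof -
    let ?x = "P (H \<eta>)" and ?y = "P (H \<xi>)"
    have xy: "?x \<in> B" "?y \<in> B" using HB mem PB by auto
    have "norm (?x - ?y) \<le> norm (H \<eta> - H \<xi>)"
      using P_norm[of "H \<eta> - H \<xi>"] P(1) by (simp add: linear_diff)
    also have "\<dots> \<le> 2 * norm (\<eta> - \<xi>)"
      using G_inv_lip[of "H \<eta>" "H \<xi>"] HB mem by simp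
    finally have 1: "norm (?x - ?y) \<le> 2 * norm (\<eta> - \<xi>)" .
    have "norm (\<psi> ?x - \<psi> ?y) \<le> C1 * norm (?x - ?y)" using d1(3) B xy by blast
    also have "\<dots> \<le> C1 * (2 * norm (\<eta> - \<xi>))" using 1 d1(2) by (rule mult_left_mono)
    finally have 2: "norm (\<psi> ?x - \<psi> ?y) \<le> C1 * (2 * norm (\<eta> - \<xi>))" .
    have "norm (f (\<psi> ?x) - f (\<psi> ?y)) \<le> C2 * norm (\<psi> ?x - \<psi> ?y)" using d2(3) B xy by blast
    also have "\<dots> \<le> C2 * (C1 * (2 * norm (\<eta> - \<xi>)))" using 2 d2(2) by (rule mult_left_mono)
    finally have 3: "norm (f (\<psi> ?x) - f (\<psi> ?y)) \<le> C2 * (C1 * (2 * norm (\<eta> - \<xi>)))" .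
    have "norm (F \<eta> - F \<xi>) \<le> norm (f (\<psi> ?x) - f (\<psi> ?y)) * kg"
      using kg(2) g(1) by (simp add: F_def linear_diff[symmetric])
    also have "\<dots> \<le> C2 * (C1 * (2 * norm (\<eta> - \<xi>))) * kg" using 3 kg(1) by simp
    finally show ?thesis by (simp add: mult_ac)
  qed
  obtain T \<eta> where T: "T > 0" and \<eta>0: "\<eta> 0 = G y0"
    and \<eta>_in: "\<And>t. t \<in> {0..T} \<Longrightarrow> \<eta> t \<in> cball (G y0) R"
    and \<eta>': "\<And>t. t \<in> {0..T} \<Longrightarrow> (\<eta> has_vector_derivative F (\<eta> t)) (at t within {0..T})"
    using picard_lindeloef[OF R(1) _ F_lip] d1(2) d2(2) kg(1)
    by (metis mult_nonneg_nonneg less_imp_le zero_le_numeral)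
  \<comment> \<open>The component orthogonal to \<open>L\<close> starts at 0 and has derivative 0,
    because \<open>F\<close> takes values in \<open>L\<close>.\<close>
  have \<eta>L: "P (\<eta> t) = \<eta> t" if t: "t \<in> {0..T}" for t
  proof -
    have "((\<lambda>t. \<eta> t - P (\<eta> t)) has_vector_derivative 0) (at t within {0..T})" if "t \<in> {0..T}" for t
    proof -
      have "((\<lambda>t. \<eta> t - P (\<eta> t)) has_vector_derivative F (\<eta> t) - P (F (\<eta> t))) (at t within {0..T})"
        by (intro has_vector_derivative_diff \<eta>'[OF that]
            bounded_linear.has_vector_derivative[OF P(1)[unfolded linear_conv_bounded_linear]])
      then show ?thesis using P(3)[OF FL] by simp
    qed
    then obtain c where "\<And>t. t \<in> {0..T} \<Longrightarrow> \<eta> t - P (\<eta> t) = c"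
      using has_vector_derivative_zero_constant[of "{0..T}" "\<lambda>t. \<eta> t - P (\<eta> t)"] by auto
    moreover have "P (\<eta> 0) = \<eta> 0"
      using \<eta>0 P(3) KL y0(2) by (simp add: G_def)
    ultimately show ?thesis using t T by (metis atLeastAtMost_iff less_imp_le order_refl right_minus_eq)
  qed

  define y where "y t = H (\<eta> t)" for t
  define z where "z t = \<psi> (y t)" for t
  have sol: "\<exists>z'. (z has_vector_derivative z') (at t within {0..T}) \<and> A *v z' = f (z t)"
    if t: "t \<in> {0..T}" for t
  proof -
    have yB: "y t \<in> B" and Gy: "G (y t) = \<eta> t"
      using HB \<eta>_in[OF t] by (auto simp: y_def)
    \<comment> \<open>The component of \<open>G y\<close> orthogonal to \<open>L\<close> is
      \<open>y - P y\<close>; it vanishes because \<eta> stays in \<open>L\<close>. The same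
      argument for \<open>G'\<close> below puts the velocity \<open>v\<close> in
      \<open>L\<close>.\<close>
    have Py: "P (y t) = y t"
    proof -
      have "P (G (y t)) = K (\<psi> (P (y t)))"
        using P(1) P(3)[OF KL] P(3)[OF P(2)] by (simp add: G_def linear_add linear_diff)
      then show ?thesis using Gy \<eta>L[OF t] by (simp add: G_def)
    qed
    then have yL: "y t \<in> L" using P(2) by metis
    have linG': "linear (G' (y t))" using G_der[OF yB] by (rule has_derivative_linear)
    then obtain H' where H': "linear H'" "\<And>x. G' (y t) (H' x) = x"
      using linear_injective_isomorphism[of "G' (y t)"] G'_inj[OF yB]
        linear_injective_0[OF linG'] by blast
    have "(H has_derivative H') (at (G (y t)))"
    proof (rule has_derivative_inverse_strong[OF _ yB G_cont HG G_der[OF yB]])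
      show "open B" by (simp add: B_def)
      show "G' (y t) \<circ> H' = id" using H' by auto
    qed
    then have y': "(y has_vector_derivative H' (F (\<eta> t))) (at t within {0..T})"
      using vector_derivative_diff_chain_within[OF \<eta>'[OF t], of H H'] Gy
      by (auto simp: comp_def y_def[abs_def] intro: has_derivative_at_withinI)
    define v where "v = H' (F (\<eta> t))"
    have G'v: "G' (y t) v = F (\<eta> t)" using H' by (simp add: v_def)
    have Pv: "P v = v"
    proof -
      have "P (G' (y t) v) = K (?D (P (y t)) (P v))"
        using P(1) P(3)[OF KL] P(3)[OF P(2)] by (simp add: G'_def linear_add linear_diff)
      then show ?thesis using G'v P(3)[OF FL] by (simp add: G'_def)
    qed
    have F_eq: "F (\<eta> t) = g (f (z t))" using Py by (simp add: F_def z_def y_def)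
    have zM: "z t \<in> M" using \<psi>M B(1)[OF yB] yL by (simp add: z_def)
    have z': "(z has_vector_derivative ?D (y t) v) (at t within {0..T})"
      using vector_derivative_diff_chain_within[OF y', of \<psi> "?D (y t)"] D[OF B(1)[OF yB]]
      by (auto simp: comp_def z_def[abs_def] v_def intro: has_derivative_at_withinI)
    \<comment> \<open>The tangent vector \<open>u\<close> with A u = f(z) has the same
      \<open>K\<close>-image as the velocity of z. Injectivity of \<open>G'\<close> identifies the
      two, so the full DAE holds and not only its image under \<open>g\<close>.\<close>
    obtain u where u: "u \<in> tangent_space M (z t)" "A *v u = f (z t)"
      using uniq zM unfolding unique_velocity_on_def is_singleton_def by blast
    then obtain l where l: "l \<in> L" "u = ?D (y t) l"
      using tangent[of "y t"] B(1)[OF yB] yL by (auto simp: z_def)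
    have "G' (y t) l = K u" using l P(3) Py by (simp add: G'_def)
    also have "\<dots> = G' (y t) v" using G'v F_eq u(2) by (simp add: K_def)
    finally have "G' (y t) (l - v) = 0" by (simp add: linear_diff[OF linG'])
    then have "l = v" using G'_inj[OF yB] by fastforce
    then show ?thesis using z' l u by blast
  qed
  show thesis
  proof (rule that[OF T])
    have sub: "{0..<T} \<subseteq> {0..T}" by auto
    show "dae_solution A f T z"
      unfolding dae_solution_def
      using sol has_vector_derivative_within_subset[OF _ sub] sub by blast
    show "z 0 = z0" using \<eta>0 HG[OF y0B] \<psi>y0 by (simp add: z_def y_def)
  qed
qed

section \<open>The sign of alpha, and the construction of S\<close>

lemma dissipated_quantity_le:
  fixes A :: "real^'d^'d"
  assumes diss: "dissipated_quantity A f V" and V: "V differentiable (at z0)"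
    and proper: "grad V z0 \<in> car A"
    and sol: "T > 0" "dae_solution A f T z" "z 0 = z0"
  shows "(pinv A *v f z0) \<bullet> grad V z0 \<le> 0"
proof -
  have 0: "0 \<in> {0..<T}" using sol(1) by simp
  obtain z' where z': "(z has_vector_derivative z') (at 0 within {0..<T})" "A *v z' = f z0"
    using sol 0 unfolding dae_solution_def by blast
  obtain D where D: "D \<le> 0" "((\<lambda>s. V (z s)) has_real_derivative D) (at 0 within {0..<T})"
    using diss sol 0 unfolding dissipated_quantity_def by blast
  have "((\<lambda>s. V (z s)) has_vector_derivative z' \<bullet> grad V z0) (at 0 within {0..<T})"
    using vector_derivative_diff_chain_within[OF z'(1), of V "\<lambda>h. h \<bullet> grad V z0"]
      grad_has_derivative[OF V] sol(3)
    by (auto simp: comp_def intro: has_derivative_at_withinI)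
  \<comment> \<open>0 is a limit point of [0,T), so the one-sided derivative is unique and the
    chain-rule value equals \<open>D\<close>.\<close>
  moreover have "at 0 within {0..<T} \<noteq> bot"
    using sol(1) by (simp add: trivial_limit_within islimpt_Ico)
  ultimately have "z' \<bullet> grad V z0 = D"
    using D(2) vector_derivative_unique_within has_real_derivative_iff_has_vector_derivative by blast
  then show ?thesis using D(1) pinv_mult_car[OF proper, of z'] z'(2) by simp
qed

theorem theorem5p8:
  fixes A :: "real^'d^'d"
    and f :: "real^'d \<Rightarrow> real^'d"
    and V :: "real^'d \<Rightarrow> real"
    and M :: "(real^'d) set"
    and r :: nat
  assumes "r \<ge> 1"
    and "Ck_on r f UNIV"
    and "regular_dae A f M"
    and "Ck_on (r + 1) V UNIV"
    and "dissipated_quantity A f V"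
    and "proper_for A M V"
  shows "\<exists>S :: real^'d \<Rightarrow> real^'d^'d.
           Ck_on r S {z. (pinv A *v f z) \<bullet> grad V z \<noteq> 0} \<and>
           (\<forall>z\<in>{z. (pinv A *v f z) \<bullet> grad V z \<noteq> 0}. f z = S z *v grad V z) \<and>
           (\<forall>z\<in>M. neg_semidef (pinv A ** S z))"
proof -
  define g where "g z = pinv A *v f z" for z
  define \<alpha> where "\<alpha> z = g z \<bullet> grad V z" for z
  define D where "D = {z. \<alpha> z \<noteq> 0}"
  \<comment> \<open>Since \<open>inverse 0 = 0\<close>, S vanishes where alpha does, which keeps it
    negative semidefinite after multiplication by A^+ at such points of M.\<close>
  define S where "S z = inverse (\<alpha> z) *\<^sub>R outer_product (f z) (g z)" for z
  have gradC: "Ck_on r (grad V) UNIV"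
    using assms(4) by (intro Ck_on_grad) auto
  have gC: "Ck_on r g UNIV"
    unfolding g_def[abs_def]
    by (rule Ck_on_bounded_linear[OF open_UNIV matrix_vector_mul_bounded_linear assms(2)])
  have \<alpha>C: "Ck_on r \<alpha> UNIV"
    unfolding \<alpha>_def[abs_def]
    by (rule Ck_on_bounded_bilinear[OF open_UNIV bounded_bilinear_inner gC gradC])
  have "Ck_on n h UNIV \<Longrightarrow> continuous_on UNIV h" for n and h :: "real^'d \<Rightarrow> real"
    by (induction n) (auto dest: Ck_on_SucD simp del: Ck_on.simps(2))
  then have "continuous_on UNIV \<alpha>" using \<alpha>C .
  then have "open D"
    unfolding D_def by (intro open_Collect_neq continuous_on_const)
  have "Ck_on r S D"
    unfolding S_def[abs_def]
    by (intro Ck_on_bounded_bilinear[OF \<open>open D\<close> bounded_bilinear_scaleR] Ck_on_inverse[OF \<open>open D\<close>]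
        Ck_on_bounded_bilinear[OF \<open>open D\<close> bounded_bilinear_outer_product])
      (use \<alpha>C gC assms(2) in \<open>auto simp: D_def intro: Ck_on_subset\<close>)
  moreover have "f z = S z *v grad V z" if "z \<in> D" for z
    using that by (simp add: S_def D_def scaleR_matrix_vector_assoc[symmetric] outer_product_mult \<alpha>_def)
  moreover have "neg_semidef (pinv A ** S z)" if zM: "z \<in> M" for z
  proof -
    obtain m where M: "submanifold m M" "unique_velocity_on A f M"
      using assms(3) unfolding regular_dae_def by blast
    have "Ck_on 1 f UNIV"
      using assms(1,2) by (induction r rule: dec_induct) (auto dest: Ck_on_SucD simp del: Ck_on.simps(2))
    then obtain T w where w: "T > 0" "dae_solution A f T w" "w 0 = z"
      by (rule dae_solution_exists[OF _ M zM])
    have "V differentiable (at z)" "grad V z \<in> car A"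
      using assms(6) zM by (auto simp: proper_for_def)
    then have "\<alpha> z \<le> 0"
      unfolding \<alpha>_def g_def by (rule dissipated_quantity_le[OF assms(5) _ _ w])
    have "x \<bullet> (pinv A ** S z *v x) = inverse (\<alpha> z) * (g z \<bullet> x)\<^sup>2" for x
      by (simp add: S_def matrix_vector_mul_assoc[symmetric] scaleR_matrix_vector_assoc[symmetric]
          outer_product_mult matrix_vector_mult_scaleR g_def[symmetric] power2_eq_square inner_commute)
    then show ?thesis
      using \<open>\<alpha> z \<le> 0\<close> by (simp add: neg_semidef_def mult_nonpos_nonneg)
  qed
  ultimately show ?thesis unfolding D_def \<alpha>_def g_def by blast
qed

end
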